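(* Let $b>0$ and let $\alpha(t)=(b\sinh^2 t,\,2b\sinh t)$, $t\in\mathbb{R}$, be the parabola with focus $F=(b,0)$. The roulette of $F$ as $\alpha$ rolls on a straight line, with arc length measured from the parameter value $0$, is the catenary $$A(t)=(bt,\;b\cosh t).$$ Moreover $|A'(t)|=b\cosh t$, and for all $t_0,t\in\mathbb{R}$, $\displaystyle\int_{t_0}^t|A'(z)|\,dz=b\sinh t-b\sinh t_0$.
   Context: Roulette of a point under rolling on a straight line: let $P(t)$ be a regular smooth plane curve with unit tangent $T(t)=P'(t)/|P'(t)|$, let $\Phi$ be a fixed point of the plane of the curve (here the focus), and let $s(t)=\int_{0}^t|P'(z)|\,dz$ be the signed arc length from parameter value $0$. Let $Q(t)$ be the orthogonal projection of $\Phi$ onto the tangent line to the curve at $P(t)$. When the curve rolls without slipping on a straight line (taken as the abscissa axis), the roulette of $\Phi$ is the curve with abscissa $s(t)-\langle P(t)-Q(t),T(t)\rangle$ and ordinate the distance $|\Phi-Q(t)|$. *)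

theory Defs
  imports "HOL-Analysis.Analysis"
begin

(* The plane is "real \<times> real", whose norm and inner product are the Euclidean ones.
   "LBINT z=a..t. f z" is oriented: for t < a it is minus the integral over [t, a]. *)

definition unit_tangent :: "(real \<Rightarrow> real \<times> real) \<Rightarrow> real \<Rightarrow> real \<times> real" where
  "unit_tangent P t = vector_derivative P (at t) /\<^sub>R norm (vector_derivative P (at t))"

definition tangent_line :: "(real \<Rightarrow> real \<times> real) \<Rightarrow> real \<Rightarrow> (real \<times> real) set" where
  "tangent_line P t = range (\<lambda>u. P t + u *\<^sub>R unit_tangent P t)"

definition signed_arc_length :: "(real \<Rightarrow> real \<times> real) \<Rightarrow> real \<Rightarrow> real \<Rightarrow> real" where
  "signed_arc_length P a t =
     (LBINT z=ereal a..ereal t. norm (vector_derivative P (at z)))"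

definition orthogonal_projection :: "'a::real_inner set \<Rightarrow> 'a \<Rightarrow> 'a" where
  "orthogonal_projection L x = (THE q. q \<in> L \<and> (\<forall>y\<in>L. orthogonal (x - q) (y - q)))"

(* Meaningful for regular smooth P: a vanishing or missing derivative leaves the
   tangent line degenerate or unspecified. *)
definition roulette :: "(real \<Rightarrow> real \<times> real) \<Rightarrow> real \<times> real \<Rightarrow> real \<Rightarrow> real \<times> real" where
  "roulette P \<Phi> t =
     (let Q = orthogonal_projection (tangent_line P t) \<Phi>
      in (signed_arc_length P 0 t - (P t - Q) \<bullet> unit_tangent P t, norm (\<Phi> - Q)))"

definition parabola :: "real \<Rightarrow> real \<Rightarrow> real \<times> real" where
  "parabola b t = (b * (sinh t)\<^sup>2, 2 * b * sinh t)"

definition catenary :: "real \<Rightarrow> real \<Rightarrow> real \<times> real" where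
  "catenary b t = (b * t, b * cosh t)"

end

theory Submission
  imports Defs
begin

text \<open>With T the unit tangent and u the component of F - P(t) along T, the foot of the
  perpendicular is Q = P + u T, so the roulette is (s + u, |F - Q|) (\<open>roulette_eq\<close>).
  For the parabola, P' = 2b cosh t (sinh t, 1) has length 2b cosh^2 t, whence s = b(t + sinh t cosh
  t), while u = -b sinh t cosh t: the hyperbolic terms cancel and the abscissa is bt. The foot is Q
  = (0, b sinh t), at distance b cosh t from F = (b, 0). The claims on the catenary follow from its
  velocity b(1, sinh t) and the primitive b sinh t of its speed.\<close>

text \<open>Discharges the uniqueness hidden in \<open>THE\<close>: for two candidates q and r, the
  vector r - q is orthogonal to both x - q and x - r, hence to their difference, which is r - q
  itself.\<close>

lemma orthogonal_projection_eqI: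
  assumes "q \<in> L" and orth: "\<And>y. y \<in> L \<Longrightarrow> orthogonal (x - q) (y - q)"
  shows "orthogonal_projection L x = q"
  unfolding orthogonal_projection_def
proof (rule the_equality)
  fix r assume r: "r \<in> L \<and> (\<forall>y\<in>L. orthogonal (x - r) (y - r))"
  have "(r - q) \<bullet> (r - q) = (x - q) \<bullet> (r - q) + (x - r) \<bullet> (q - r)"
    by (simp add: inner_diff_left inner_diff_right inner_commute)
  also have "\<dots> = 0"
    using r orth[of r] \<open>q \<in> L\<close> by (simp add: orthogonal_def)
  finally show "r = q" by simp
qed (use assms in auto)

lemma orthogonal_projection_unit_line:
  assumes "norm v = 1"
  shows "orthogonal_projection (range (\<lambda>u. p + u *\<^sub>R v)) x = p + ((x - p) \<bullet> v) *\<^sub>R v"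
proof (rule orthogonal_projection_eqI)
  fix y assume "y \<in> range (\<lambda>u. p + u *\<^sub>R v)"
  then obtain u where y: "y = p + u *\<^sub>R v" by auto
  have diff: "y - (p + ((x - p) \<bullet> v) *\<^sub>R v) = (u - (x - p) \<bullet> v) *\<^sub>R v"
    by (simp add: y scaleR_left_diff_distrib)
  have "v \<bullet> v = 1"
    using assms by (simp add: dot_square_norm)
  then have "(x - (p + ((x - p) \<bullet> v) *\<^sub>R v)) \<bullet> v = 0"
    by (simp add: inner_diff_left inner_add_left)
  then show "orthogonal (x - (p + ((x - p) \<bullet> v) *\<^sub>R v)) (y - (p + ((x - p) \<bullet> v) *\<^sub>R v))"
    unfolding diff by (simp add: orthogonal_def)
qed auto

text \<open>Since P - Q = -u T and T has norm 1, subtracting the tangential component of P - Q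
  amounts to adding u. Regularity at t is what makes T a unit vector.\<close>

lemma roulette_eq:
  fixes \<Phi> :: "real \<times> real"
  assumes "vector_derivative P (at t) \<noteq> 0"
  defines "u \<equiv> (\<Phi> - P t) \<bullet> unit_tangent P t"
  shows "roulette P \<Phi> t =
    (signed_arc_length P 0 t + u, norm (\<Phi> - (P t + u *\<^sub>R unit_tangent P t)))"
proof -
  have unit: "norm (unit_tangent P t) = 1"
    using assms by (simp add: unit_tangent_def)
  then have "unit_tangent P t \<bullet> unit_tangent P t = 1"
    by (simp add: dot_square_norm)
  then show ?thesis
    using unit by (simp add: roulette_def tangent_line_def orthogonal_projection_unit_line u_def Let_def)
qed

text \<open>The scalar is kept outside the pair so that \<open>norm_scaleR\<close> leaves exactly
  the norm in \<open>norm_sinh_one\<close>.\<close>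

lemma vector_derivative_parabola:
  "vector_derivative (parabola b) (at t) = (2 * b * cosh t) *\<^sub>R (sinh t, 1)"
proof -
  have "(parabola b has_vector_derivative (2 * b * sinh t * cosh t, 2 * b * cosh t)) (at t)"
    unfolding parabola_def
    by (intro has_vector_derivative_Pair)
      (auto intro!: derivative_eq_intros simp flip: has_real_derivative_iff_has_vector_derivative)
  then show ?thesis
    by (simp add: vector_derivative_at)
qed

lemma norm_sinh_one: "norm (sinh t, 1 :: real) = cosh (t :: real)"
  by (simp add: norm_Pair sinh_square_eq)

lemma norm_vector_derivative_parabola:
  assumes "b \<ge> 0"
  shows "norm (vector_derivative (parabola b) (at t)) = 2 * b * (cosh t)\<^sup>2"
  using assms unfolding vector_derivative_parabola norm_scaleR norm_sinh_one
  by (simp add: abs_mult power2_eq_square)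

lemma unit_tangent_parabola:
  assumes "b > 0"
  shows "unit_tangent (parabola b) t = (sinh t, 1) /\<^sub>R cosh t"
  using assms cosh_real_pos[of t]
  unfolding unit_tangent_def vector_derivative_parabola norm_scaleR norm_sinh_one
  by (simp add: field_simps)

lemma signed_arc_length_parabola:
  assumes "b \<ge> 0"
  shows "signed_arc_length (parabola b) 0 t = b * (t + sinh t * cosh t)"
proof -
  have "(LBINT z=ereal 0..ereal t. 2 * b * (cosh z)\<^sup>2) =
      b * (t + sinh t * cosh t) - b * (0 + sinh 0 * cosh 0)"
  proof (rule interval_integral_FTC_finite)
    fix x :: real
    \<comment> \<open>The primitive comes from 2 cosh^2 = 1 + (cosh^2 + sinh^2), where the bracket
      is the derivative of sinh cosh.\<close>
    have "((\<lambda>t. b * (t + sinh t * cosh t)) has_real_derivative 2 * b * (cosh x)\<^sup>2) (at x)"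
      by (auto intro!: derivative_eq_intros simp: cosh_square_eq power2_eq_square[symmetric] algebra_simps)
    \<comment> \<open>The interval from \<open>min\<close> to \<open>max\<close> covers negative t,
      where the integral is oriented backwards.\<close>
    then show "((\<lambda>t. b * (t + sinh t * cosh t)) has_vector_derivative 2 * b * (cosh x)\<^sup>2)
        (at x within {min 0 t..max 0 t})"
      by (simp add: has_real_derivative_iff_has_vector_derivative has_vector_derivative_at_within)
  qed (intro continuous_intros)
  then show ?thesis
    using assms by (simp add: signed_arc_length_def norm_vector_derivative_parabola)
qed

lemma norm_vector_derivative_catenary:
  assumes "b \<ge> 0"
  shows "norm (vector_derivative (catenary b) (at t)) = b * cosh t"
proof -
  have "(catenary b has_vector_derivative (b, b * sinh t)) (at t)"
    unfolding catenary_def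
    by (intro has_vector_derivative_Pair)
      (auto intro!: derivative_eq_intros simp flip: has_real_derivative_iff_has_vector_derivative)
  then have "vector_derivative (catenary b) (at t) = b *\<^sub>R (1, sinh t)"
    by (simp add: vector_derivative_at)
  moreover have "norm (1 :: real, sinh t) = cosh t"
    using norm_sinh_one[of t] by (simp add: norm_Pair add.commute)
  ultimately show ?thesis
    using assms by (simp only: norm_scaleR abs_of_nonneg)
qed

lemma roulette_parabola_focus:
  assumes "b > 0"
  shows "roulette (parabola b) (b, 0) t = catenary b t"
proof -
  let ?T = "unit_tangent (parabola b) t"
  have T: "?T = (sinh t / cosh t, 1 / cosh t)"
    using assms by (simp add: unit_tangent_parabola divide_inverse mult.commute)
  have regular: "vector_derivative (parabola b) (at t) \<noteq> 0"
    using assms by (simp add: vector_derivative_parabola zero_prod_def)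
  \<comment> \<open>The numerator is (b - b sinh^2 t) sinh t - 2b sinh t; its factor 1 + sinh^2 t =
    cosh^2 t then absorbs the denominator.\<close>
  have "((b, 0) - parabola b t) \<bullet> ?T = - (b * sinh t * (1 + (sinh t)\<^sup>2)) / cosh t"
    by (simp add: T parabola_def inner_Pair diff_divide_distrib[symmetric] add_divide_distrib[symmetric]
        algebra_simps power2_eq_square)
  also have "\<dots> = - (b * sinh t * cosh t)"
    unfolding sinh_square_eq by (simp add: power2_eq_square)
  finally have u: "((b, 0) - parabola b t) \<bullet> ?T = - (b * sinh t * cosh t)" .
  \<comment> \<open>The foot of the perpendicular lies on the tangent at the vertex.\<close>
  have Q: "parabola b t + (- (b * sinh t * cosh t)) *\<^sub>R ?T = (0, b * sinh t)"
    by (simp add: T parabola_def power2_eq_square)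
  \<comment> \<open>Swapping coordinates and changing a sign preserve the norm, so
    \<open>norm_sinh_one\<close> applies again.\<close>
  have "norm ((b, 0) - (0, b * sinh t)) = norm (b *\<^sub>R (sinh t, 1 :: real))"
    by (simp add: norm_Pair add.commute)
  also have "\<dots> = b * cosh t"
    using assms by (simp only: norm_scaleR norm_sinh_one)
  finally show ?thesis
    unfolding roulette_eq[OF regular] u Q catenary_def
    using assms by (simp add: signed_arc_length_parabola algebra_simps)
qed

theorem mainTheorem3:
  fixes b :: real
  assumes "b > 0"
  shows "(\<forall>t. roulette (parabola b) (b, 0) t = catenary b t)
    \<and> (\<forall>t. norm (vector_derivative (catenary b) (at t)) = b * cosh t)
    \<and> (\<forall>t0 t. (LBINT z=ereal t0..ereal t. norm (vector_derivative (catenary b) (at z)))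
               = b * sinh t - b * sinh t0)"
proof (intro conjI allI)
  fix t0 t :: real
  have "(LBINT z=ereal t0..ereal t. b * cosh z) = b * sinh t - b * sinh t0"
  proof (rule interval_integral_FTC_finite)
    fix x :: real
    have "((\<lambda>t. b * sinh t) has_real_derivative b * cosh x) (at x)"
      by (auto intro!: derivative_eq_intros)
    then show "((\<lambda>t. b * sinh t) has_vector_derivative b * cosh x)
        (at x within {min t0 t..max t0 t})"
      by (simp add: has_real_derivative_iff_has_vector_derivative has_vector_derivative_at_within)
  qed (intro continuous_intros)
  then show "(LBINT z=ereal t0..ereal t. norm (vector_derivative (catenary b) (at z)))
      = b * sinh t - b * sinh t0"
    using assms by (simp add: norm_vector_derivative_catenary)
qed (use assms in \<open>simp_all add: roulette_parabola_focus norm_vector_derivative_catenary\<close>)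

end
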